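(* Let $M$ be a finite monoid, $J\subset M$ a $\mathcal J$-class, $a\in J$, and denote by $H_0=\mathcal H(a)$, $R_0=\mathcal R(a)$, $L_0=\mathcal L(a)$ the $\mathcal H$-, $\mathcal R$- and $\mathcal L$-class of $a$. Let $h,k\in M$. Choose - for each $\mathcal R$-class $R\subset J$ a left Green pair $(\lambda_R,\lambda_R')$ with respect to $(R_0,R)$, - for each $\mathcal L$-class $L\subset J$ a right Green pair $(\rho_L,\rho_L')$ with respect to $(L_0,L)$. Put $S_{\mathcal R}(h)=\{R\subset J : R \text{ is an } \mathcal R\text{-class and } hR=R\}$ and $S_{\mathcal L}(k)=\{L\subset J : L\text{ is an }\mathcal L\text{-class and } Lk=L\}$. Let $C$ be the set of conjugacy classes of the right Schützenberger group $\Gamma'(H_0)$, writing $\bar g$ for the class of $g$, and let $C_{\Gamma'(H_0)}(g)$ denote the centralizer of $g$ in $\Gamma'(H_0)$. Define two vectors indexed by $C$: $$r_J(h)=\Big(|C_{\Gamma'(H_0)}(g)|\cdot\big|\{R\in S_{\mathcal R}(h) : \tau_a(\lambda_R' h\lambda_R)^{-1}\in\bar g\}\big|\Big)_{\bar g\in C},$$ $$l_J(k)=\Big(\big|\{L\in S_{\mathcal L}(k) : \rho_L k\rho_L'\in\bar g\}\big|\Big)_{\bar g\in C},$$ where $\lambda_R'h\lambda_R$ is identified with the element $x\mapsto \lambda_R'h\lambda_R x$ of the left Schützenberger group $\Gamma(H_0)$ and $\rho_Lk\rho_L'$ with the element $x\mapsto x\rho_Lk\rho_L'$ of $\Gamma'(H_0)$.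 Then the set $\{s\in J : hsk=s\}$ has cardinality equal to the dot product of $r_J(h)$ with $l_J(k)$.
   Context: Green's relations on a finite monoid $M$: $a,b$ are in the same $\mathcal L$-class iff $Ma=Mb$; same $\mathcal R$-class iff $aM=bM$; same $\mathcal J$-class iff $MaM=MbM$; same $\mathcal H$-class iff they are in the same $\mathcal L$-class and the same $\mathcal R$-class. Left Green pair with respect to two $\mathcal R$-classes $(R,R')$ in the same $\mathcal J$-class: a pair $(\lambda,\lambda')\in M^2$ with $\lambda R=R'$, $\lambda'R'=R$, $\lambda'\lambda x=x$ for all $x\in R$, and $\lambda\lambda'y=y$ for all $y\in R'$. Right Green pair with respect to two $\mathcal L$-classes $(L,L')$ in the same $\mathcal J$-class: a pair $(\rho,\rho')\in M^2$ with $L\rho=L'$, $L'\rho'=L$, $x\rho\rho'=x$ for all $x\in L$, and $y\rho'\rho=y$ for all $y\in L'$. Schützenberger groups of an $\mathcal H$-class $H$: $\Gamma(H)$ is the group, under composition, of the maps $H\to H$, $x\mapsto mx$, for $m\in M$ with $mH=H$; $\Gamma'(H)$ is the group, under composition, of the maps $H\to H$, $x\mapsto xm$, for $m\in M$ with $Hm=H$. Both act freely and transitively on $H$. Write $g\cdot a$ for the action of $g\in\Gamma(H)$ on $a\in H$ and $a\cdot g'$ for the action of $g'\in\Gamma'(H)$ on $a$. For $a\in H$ and $g\in\Gamma(H)$, $\tau_a(g)$ is the unique element of $\Gamma'(H)$ such that $g\cdot a=a\cdot\tau_a(g)$. *)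

theory Defs
  imports "HOL-Algebra.Coset"
begin

section \<open>Green's relations\<close>

definition L_class :: "('a, 'b) monoid_scheme \<Rightarrow> 'a \<Rightarrow> 'a set" where
  "L_class M a = {b \<in> carrier M. carrier M #>\<^bsub>M\<^esub> b = carrier M #>\<^bsub>M\<^esub> a}"

definition R_class :: "('a, 'b) monoid_scheme \<Rightarrow> 'a \<Rightarrow> 'a set" where
  "R_class M a = {b \<in> carrier M. b <#\<^bsub>M\<^esub> carrier M = a <#\<^bsub>M\<^esub> carrier M}"

definition J_class :: "('a, 'b) monoid_scheme \<Rightarrow> 'a \<Rightarrow> 'a set" where
  "J_class M a = {b \<in> carrier M.
     (carrier M #>\<^bsub>M\<^esub> b) <#>\<^bsub>M\<^esub> carrier M = (carrier M #>\<^bsub>M\<^esub> a) <#>\<^bsub>M\<^esub> carrier M}"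

definition H_class :: "('a, 'b) monoid_scheme \<Rightarrow> 'a \<Rightarrow> 'a set" where
  "H_class M a = L_class M a \<inter> R_class M a"

definition L_classes :: "('a, 'b) monoid_scheme \<Rightarrow> 'a set set" where
  "L_classes M = L_class M ` carrier M"

definition R_classes :: "('a, 'b) monoid_scheme \<Rightarrow> 'a set set" where
  "R_classes M = R_class M ` carrier M"

definition J_classes :: "('a, 'b) monoid_scheme \<Rightarrow> 'a set set" where
  "J_classes M = J_class M ` carrier M"


section \<open>Green pairs\<close>

definition left_Green_pair ::
  "('a, 'b) monoid_scheme \<Rightarrow> 'a set \<Rightarrow> 'a set \<Rightarrow> 'a \<Rightarrow> 'a \<Rightarrow> bool" where
  "left_Green_pair M R R' l l' \<longleftrightarrow>
     l \<in> carrier M \<and> l' \<in> carrier M \<and>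
     l <#\<^bsub>M\<^esub> R = R' \<and> l' <#\<^bsub>M\<^esub> R' = R \<and>
     (\<forall>x\<in>R. l' \<otimes>\<^bsub>M\<^esub> l \<otimes>\<^bsub>M\<^esub> x = x) \<and>
     (\<forall>y\<in>R'. l \<otimes>\<^bsub>M\<^esub> l' \<otimes>\<^bsub>M\<^esub> y = y)"

definition right_Green_pair ::
  "('a, 'b) monoid_scheme \<Rightarrow> 'a set \<Rightarrow> 'a set \<Rightarrow> 'a \<Rightarrow> 'a \<Rightarrow> bool" where
  "right_Green_pair M L L' r r' \<longleftrightarrow>
     r \<in> carrier M \<and> r' \<in> carrier M \<and>
     L #>\<^bsub>M\<^esub> r = L' \<and> L' #>\<^bsub>M\<^esub> r' = L \<and>
     (\<forall>x\<in>L. x \<otimes>\<^bsub>M\<^esub> r \<otimes>\<^bsub>M\<^esub> r' = x) \<and>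
     (\<forall>y\<in>L'. y \<otimes>\<^bsub>M\<^esub> r' \<otimes>\<^bsub>M\<^esub> r = y)"


section \<open>Schuetzenberger groups\<close>

text \<open>Maps \<open>H \<rightarrow> H\<close> are represented by extensional functions (\<open>undefined\<close> outside \<open>H\<close>), so that
  two multipliers inducing the same map on \<open>H\<close> give the same group element. Both groups carry the
  ordinary composition of maps.\<close>

definition left_mult_map :: "('a, 'b) monoid_scheme \<Rightarrow> 'a set \<Rightarrow> 'a \<Rightarrow> 'a \<Rightarrow> 'a" where
  "left_mult_map M H m = (\<lambda>x\<in>H. m \<otimes>\<^bsub>M\<^esub> x)"

definition right_mult_map :: "('a, 'b) monoid_scheme \<Rightarrow> 'a set \<Rightarrow> 'a \<Rightarrow> 'a \<Rightarrow> 'a" where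
  "right_mult_map M H m = (\<lambda>x\<in>H. x \<otimes>\<^bsub>M\<^esub> m)"

definition left_schutz :: "('a, 'b) monoid_scheme \<Rightarrow> 'a set \<Rightarrow> ('a \<Rightarrow> 'a) monoid" where
  "left_schutz M H =
     \<lparr>carrier = left_mult_map M H ` {m \<in> carrier M. m <#\<^bsub>M\<^esub> H = H},
      mult = compose H, one = (\<lambda>x\<in>H. x)\<rparr>"

definition right_schutz :: "('a, 'b) monoid_scheme \<Rightarrow> 'a set \<Rightarrow> ('a \<Rightarrow> 'a) monoid" where
  "right_schutz M H =
     \<lparr>carrier = right_mult_map M H ` {m \<in> carrier M. H #>\<^bsub>M\<^esub> m = H},
      mult = compose H, one = (\<lambda>x\<in>H. x)\<rparr>"

text \<open>\<open>tau M a\<close> is meaningful on the carrier of \<open>left_schutz M (H_class M a)\<close>; there the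
  witness is unique because the right Schuetzenberger group acts freely and transitively.\<close>

definition tau :: "('a, 'b) monoid_scheme \<Rightarrow> 'a \<Rightarrow> ('a \<Rightarrow> 'a) \<Rightarrow> ('a \<Rightarrow> 'a)" where
  "tau M a g = (THE g'. g' \<in> carrier (right_schutz M (H_class M a)) \<and> g a = g' a)"


section \<open>Conjugacy classes and centralizers\<close>

definition conj_class :: "('g, 'c) monoid_scheme \<Rightarrow> 'g \<Rightarrow> 'g set" where
  "conj_class G g = {x \<otimes>\<^bsub>G\<^esub> g \<otimes>\<^bsub>G\<^esub> inv\<^bsub>G\<^esub> x | x. x \<in> carrier G}"

definition conj_classes :: "('g, 'c) monoid_scheme \<Rightarrow> 'g set set" where
  "conj_classes G = conj_class G ` carrier G"

definition centralizer :: "('g, 'c) monoid_scheme \<Rightarrow> 'g \<Rightarrow> 'g set" where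
  "centralizer G g = {x \<in> carrier G. x \<otimes>\<^bsub>G\<^esub> g = g \<otimes>\<^bsub>G\<^esub> x}"

text \<open>The common cardinality of the centralizers of the elements of a conjugacy class; lemma
  \<open>class_centralizer_card\<close> shows that the chosen representative is irrelevant.\<close>

definition class_centralizer_card :: "('g, 'c) monoid_scheme \<Rightarrow> 'g set \<Rightarrow> nat" where
  "class_centralizer_card G c = card (centralizer G (SOME g. g \<in> c))"

lemma (in group) card_centralizer_conj:
  assumes g: "g \<in> carrier G" and y: "y \<in> carrier G"
  shows "card (centralizer G (y \<otimes> g \<otimes> inv y)) = card (centralizer G g)"
proof -
  have cancel: "inv y \<otimes> (y \<otimes> z) = z" "y \<otimes> (inv y \<otimes> z) = z" if "z \<in> carrier G" for z
    using that y by (simp_all flip: m_assoc)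
  have "bij_betw (\<lambda>x. y \<otimes> x \<otimes> inv y) (centralizer G g) (centralizer G (y \<otimes> g \<otimes> inv y))"
  proof (rule bij_betwI[where g = "\<lambda>x. inv y \<otimes> x \<otimes> y"])
    show "(\<lambda>x. y \<otimes> x \<otimes> inv y) \<in> centralizer G g \<rightarrow> centralizer G (y \<otimes> g \<otimes> inv y)"
    proof
      fix x assume "x \<in> centralizer G g"
      then have x: "x \<in> carrier G" "x \<otimes> g = g \<otimes> x" by (auto simp: centralizer_def)
      have "x \<otimes> (g \<otimes> inv y) = g \<otimes> (x \<otimes> inv y)"
        using x g y by (simp flip: m_assoc)
      then show "y \<otimes> x \<otimes> inv y \<in> centralizer G (y \<otimes> g \<otimes> inv y)"
        using x g y by (simp add: centralizer_def m_assoc cancel)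
    qed
  next
    show "(\<lambda>x. inv y \<otimes> x \<otimes> y) \<in> centralizer G (y \<otimes> g \<otimes> inv y) \<rightarrow> centralizer G g"
    proof
      fix x assume "x \<in> centralizer G (y \<otimes> g \<otimes> inv y)"
      then have x: "x \<in> carrier G" "x \<otimes> (y \<otimes> g \<otimes> inv y) = y \<otimes> g \<otimes> inv y \<otimes> x"
        by (auto simp: centralizer_def)
      have "inv y \<otimes> (x \<otimes> (y \<otimes> g \<otimes> inv y)) \<otimes> y = inv y \<otimes> (y \<otimes> g \<otimes> inv y \<otimes> x) \<otimes> y"
        using x(2) by simp
      then show "inv y \<otimes> x \<otimes> y \<in> centralizer G g"
        using x(1) g y by (simp add: centralizer_def m_assoc cancel)
    qed
  qed (use y in \<open>auto simp: centralizer_def m_assoc cancel\<close>)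
  then show ?thesis by (simp add: bij_betw_same_card)
qed

lemma (in group) class_centralizer_card:
  assumes "g \<in> carrier G"
  shows "class_centralizer_card G (conj_class G g) = card (centralizer G g)"
proof -
  have "\<one> \<otimes> g \<otimes> inv \<one> \<in> conj_class G g"
    unfolding conj_class_def by blast
  then have "(SOME g'. g' \<in> conj_class G g) \<in> conj_class G g" by (rule someI)
  then obtain y where "y \<in> carrier G" "(SOME g'. g' \<in> conj_class G g) = y \<otimes> g \<otimes> inv y"
    by (auto simp: conj_class_def)
  then show ?thesis
    using assms by (simp add: class_centralizer_card_def card_centralizer_conj)
qed


section \<open>The vectors indexed by conjugacy classes\<close>

definition S_R :: "('a, 'b) monoid_scheme \<Rightarrow> 'a set \<Rightarrow> 'a \<Rightarrow> 'a set set" where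
  "S_R M J h = {R \<in> R_classes M. R \<subseteq> J \<and> h <#\<^bsub>M\<^esub> R = R}"

definition S_L :: "('a, 'b) monoid_scheme \<Rightarrow> 'a set \<Rightarrow> 'a \<Rightarrow> 'a set set" where
  "S_L M J k = {L \<in> L_classes M. L \<subseteq> J \<and> L #>\<^bsub>M\<^esub> k = L}"

definition r_vec ::
  "('a, 'b) monoid_scheme \<Rightarrow> 'a set \<Rightarrow> 'a \<Rightarrow> ('a set \<Rightarrow> 'a) \<Rightarrow> ('a set \<Rightarrow> 'a) \<Rightarrow> 'a
    \<Rightarrow> ('a \<Rightarrow> 'a) set \<Rightarrow> nat" where
  "r_vec M J a lam lam' h c =
     class_centralizer_card (right_schutz M (H_class M a)) c *
     card {R \<in> S_R M J h.
       inv\<^bsub>right_schutz M (H_class M a)\<^esub>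
         (tau M a (left_mult_map M (H_class M a) (lam' R \<otimes>\<^bsub>M\<^esub> h \<otimes>\<^bsub>M\<^esub> lam R))) \<in> c}"

definition l_vec ::
  "('a, 'b) monoid_scheme \<Rightarrow> 'a set \<Rightarrow> 'a \<Rightarrow> ('a set \<Rightarrow> 'a) \<Rightarrow> ('a set \<Rightarrow> 'a) \<Rightarrow> 'a
    \<Rightarrow> ('a \<Rightarrow> 'a) set \<Rightarrow> nat" where
  "l_vec M J a rho rho' k c =
     card {L \<in> S_L M J k.
       right_mult_map M (H_class M a) (rho L \<otimes>\<^bsub>M\<^esub> k \<otimes>\<^bsub>M\<^esub> rho' L) \<in> c}"

end

theory Submission
  imports Defs
begin

text \<open>If \<open>h s k = s\<close> with \<open>s \<in> J\<close>, then finiteness (stability, lemmas \<open>left_stable\<close> and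
  \<open>right_stable\<close>) forces \<open>h\<close> to permute the \<open>\<R>\<close>-class \<open>R\<close> of \<open>s\<close> and \<open>k\<close> to permute its
  \<open>\<L>\<close>-class \<open>L\<close> (\<open>fixed_point_classes\<close>). So the solutions are distributed over the sets
  \<open>R \<inter> L\<close> with \<open>R\<close> and \<open>L\<close> among the classes stabilised by \<open>h\<close> and \<open>k\<close>.

  Green pairs identify \<open>R \<inter> L\<close> with the base class \<open>H\<close> of \<open>a\<close> through \<open>x \<mapsto> l x r\<close>, and turn the
  equation into \<open>(l' h l) x (r k r') = x\<close>. The group \<open>\<Gamma>'(H)\<close> acts freely and transitively on \<open>H\<close>,
  so \<open>x = f a\<close> for exactly one \<open>f\<close> in it. Left multiplications commute with right ones; hence the
  left factor can be moved onto \<open>a\<close>, where it agrees with \<open>t = \<tau>(l' h l)\<close>. With \<open>b\<close> the right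
  multiplication by \<open>r k r'\<close>, the equation is the identity \<open>b f t = f\<close> in \<open>\<Gamma>'(H)\<close>: the element \<open>f\<close>
  conjugates \<open>t\<inverse>\<close> into \<open>b\<close> (\<open>card_fixed_in_class\<close>).

  The number of such \<open>f\<close> is the order of a centralizer if \<open>t\<inverse>\<close>, which depends on \<open>R\<close> only, and
  \<open>b\<close>, which depends on \<open>L\<close> only, are conjugate, and it is zero otherwise. Sorting the pairs
  \<open>(R, L)\<close> by the common conjugacy class gives the dot product (\<open>sum_card_conjugators\<close>).\<close>

section \<open>Conjugating one element of a group into another\<close>

context group
begin

lemma conj_class_self: "g \<in> carrier G \<Longrightarrow> g \<in> conj_class G g"
  unfolding conj_class_def by (rule CollectI, rule exI[of _ \<one>]) simp

lemma conj_class_eq: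
  assumes g: "g \<in> carrier G" and b: "b \<in> conj_class G g"
  shows "conj_class G b = conj_class G g"
proof -
  obtain y where y: "y \<in> carrier G" "b = y \<otimes> g \<otimes> inv y"
    using b by (auto simp: conj_class_def)
  have "x \<otimes> b \<otimes> inv x = (x \<otimes> y) \<otimes> g \<otimes> inv (x \<otimes> y)"
    and "x \<otimes> g \<otimes> inv x = (x \<otimes> inv y) \<otimes> b \<otimes> inv (x \<otimes> inv y)" if "x \<in> carrier G" for x
  proof -
    have cancel: "inv y \<otimes> (y \<otimes> z) = z" if "z \<in> carrier G" for z
      using that y by (simp flip: m_assoc)
    show "x \<otimes> b \<otimes> inv x = (x \<otimes> y) \<otimes> g \<otimes> inv (x \<otimes> y)"
      and "x \<otimes> g \<otimes> inv x = (x \<otimes> inv y) \<otimes> b \<otimes> inv (x \<otimes> inv y)"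
      using that y g by (simp_all add: m_assoc inv_mult_group cancel)
  qed
  then show ?thesis
    unfolding conj_class_def using y(1) by blast
qed

text \<open>If \<open>y\<close> conjugates \<open>g\<close> into \<open>b\<close>, all the conjugating elements form the coset of the
  centralizer of \<open>g\<close> that contains \<open>y\<close>.\<close>

lemma card_conjugators:
  assumes g: "g \<in> carrier G"
  shows "card {x \<in> carrier G. x \<otimes> g \<otimes> inv x = b} =
    (if b \<in> conj_class G g then card (centralizer G g) else 0)"
proof (cases "b \<in> conj_class G g")
  case False
  then have "{x \<in> carrier G. x \<otimes> g \<otimes> inv x = b} = {}"
    by (auto simp: conj_class_def)
  then show ?thesis using False by (simp only: card.empty if_False)
next
  case True
  then obtain y where y: "y \<in> carrier G" and b: "b = y \<otimes> g \<otimes> inv y"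
    by (auto simp: conj_class_def)
  have cancel: "inv z \<otimes> (z \<otimes> w) = w" "z \<otimes> (inv z \<otimes> w) = w"
    if "z \<in> carrier G" "w \<in> carrier G" for z w
    using that by (simp_all flip: m_assoc)
  have "bij_betw (\<lambda>x. y \<otimes> x) (centralizer G g) {x \<in> carrier G. x \<otimes> g \<otimes> inv x = b}"
  proof (rule bij_betwI[where g = "\<lambda>x. inv y \<otimes> x"])
    show "(\<lambda>x. y \<otimes> x) \<in> centralizer G g \<rightarrow> {x \<in> carrier G. x \<otimes> g \<otimes> inv x = b}"
    proof
      fix x assume "x \<in> centralizer G g"
      then have x: "x \<in> carrier G" "x \<otimes> g = g \<otimes> x" by (auto simp: centralizer_def)
      have "y \<otimes> x \<otimes> g \<otimes> inv (y \<otimes> x) = y \<otimes> (x \<otimes> g) \<otimes> (inv x \<otimes> inv y)"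
        using x(1) g y by (simp add: m_assoc inv_mult_group)
      also have "\<dots> = b"
        using x(1) g y unfolding x(2) by (simp add: m_assoc cancel b)
      finally show "y \<otimes> x \<in> {x \<in> carrier G. x \<otimes> g \<otimes> inv x = b}"
        using x(1) y by simp
    qed
  next
    show "(\<lambda>x. inv y \<otimes> x) \<in> {x \<in> carrier G. x \<otimes> g \<otimes> inv x = b} \<rightarrow> centralizer G g"
    proof
      fix x assume "x \<in> {x \<in> carrier G. x \<otimes> g \<otimes> inv x = b}"
      then have x: "x \<in> carrier G" "x \<otimes> g \<otimes> inv x = y \<otimes> g \<otimes> inv y" by (auto simp: b)
      have "inv y \<otimes> (x \<otimes> g \<otimes> inv x) \<otimes> x = inv y \<otimes> (y \<otimes> g \<otimes> inv y) \<otimes> x"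
        using x(2) by simp
      then show "inv y \<otimes> x \<in> centralizer G g"
        using x(1) g y by (simp add: centralizer_def m_assoc cancel)
    qed
  qed (use y in \<open>auto simp: centralizer_def cancel\<close>)
  then show ?thesis using True by (simp add: bij_betw_same_card)
qed

lemma conj_classes_mem_iff:
  assumes "c \<in> conj_classes G" and "g \<in> carrier G"
  shows "g \<in> c \<longleftrightarrow> c = conj_class G g"
  using assms unfolding conj_classes_def by (metis conj_class_eq conj_class_self imageE)

text \<open>Grouping pairs by the conjugacy class of the first entry: a pair contributes the order of
  the common centralizer precisely when the second entry lies in the same class.\<close>

lemma sum_card_conjugators:
  assumes fin: "finite (carrier G)" "finite A" "finite B"
    and f: "\<And>i. i \<in> A \<Longrightarrow> f i \<in> carrier G" and g: "\<And>j. j \<in> B \<Longrightarrow> g j \<in> carrier G"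
  shows "(\<Sum>i\<in>A. \<Sum>j\<in>B. card {x \<in> carrier G. x \<otimes> f i \<otimes> inv x = g j}) =
    (\<Sum>c \<in> conj_classes G.
       class_centralizer_card G c * card {i \<in> A. f i \<in> c} * card {j \<in> B. g j \<in> c})"
proof -
  have finC: "finite (conj_classes G)" using fin by (simp add: conj_classes_def)
  have "card {x \<in> carrier G. x \<otimes> f i \<otimes> inv x = g j} =
      (\<Sum>c \<in> conj_classes G.
         class_centralizer_card G c * of_bool (f i \<in> c) * of_bool (g j \<in> c))"
    if ij: "i \<in> A" "j \<in> B" for i j
  proof -
    have cls: "conj_class G (f i) \<in> conj_classes G"
      using f ij by (simp add: conj_classes_def)
    have "(\<Sum>c \<in> conj_classes G.
         class_centralizer_card G c * of_bool (f i \<in> c) * of_bool (g j \<in> c)) =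
      (\<Sum>c \<in> conj_classes G. if c = conj_class G (f i)
         then class_centralizer_card G c * of_bool (g j \<in> c) else 0)"
      using f ij by (intro sum.cong) (auto simp: conj_classes_mem_iff)
    also have "\<dots> = class_centralizer_card G (conj_class G (f i)) *
        of_bool (g j \<in> conj_class G (f i))"
      using finC cls by simp
    finally show ?thesis
      using f ij by (simp add: card_conjugators class_centralizer_card)
  qed
  then have "(\<Sum>i\<in>A. \<Sum>j\<in>B. card {x \<in> carrier G. x \<otimes> f i \<otimes> inv x = g j}) =
      (\<Sum>i\<in>A. \<Sum>j\<in>B. \<Sum>c \<in> conj_classes G.
         class_centralizer_card G c * of_bool (f i \<in> c) * of_bool (g j \<in> c))"
    by simp
  also have "\<dots> = (\<Sum>i\<in>A. \<Sum>c \<in> conj_classes G. \<Sum>j\<in>B.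
         class_centralizer_card G c * of_bool (f i \<in> c) * of_bool (g j \<in> c))"
    by (intro sum.cong refl sum.swap)
  also have "\<dots> = (\<Sum>c \<in> conj_classes G. \<Sum>i\<in>A. \<Sum>j\<in>B.
         class_centralizer_card G c * of_bool (f i \<in> c) * of_bool (g j \<in> c))"
    by (rule sum.swap)
  also have "\<dots> = (\<Sum>c \<in> conj_classes G.
       class_centralizer_card G c * card {i \<in> A. f i \<in> c} * card {j \<in> B. g j \<in> c})"
  proof (rule sum.cong[OF refl])
    fix c
    have "card {i \<in> A. f i \<in> c} = (\<Sum>i\<in>A. of_bool (f i \<in> c))"
      and "card {j \<in> B. g j \<in> c} = (\<Sum>j\<in>B. of_bool (g j \<in> c))"
      using fin by (simp_all add: of_bool_def sum.If_cases Int_def)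
    then show "(\<Sum>i\<in>A. \<Sum>j\<in>B.
         class_centralizer_card G c * of_bool (f i \<in> c) * of_bool (g j \<in> c)) =
       class_centralizer_card G c * card {i \<in> A. f i \<in> c} * card {j \<in> B. g j \<in> c}"
      by (simp only: sum_distrib_left[symmetric] sum_distrib_right[symmetric])
  qed
  finally show ?thesis .
qed

end


section \<open>Green's relations in a finite monoid\<close>

locale finite_monoid = monoid M for M (structure) +
  assumes finite_carrier: "finite (carrier M)"
begin

lemma left_ideal_subset_iff:
  assumes "a \<in> carrier M" "b \<in> carrier M"
  shows "carrier M #> b \<subseteq> carrier M #> a \<longleftrightarrow> (\<exists>u\<in>carrier M. b = u \<otimes> a)"
proof
  assume "carrier M #> b \<subseteq> carrier M #> a"
  moreover have "b \<in> carrier M #> b" using assms by (auto simp: r_coset_def intro!: bexI[of _ \<one>])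
  ultimately show "\<exists>u\<in>carrier M. b = u \<otimes> a" by (auto simp: r_coset_def)
next
  assume "\<exists>u\<in>carrier M. b = u \<otimes> a"
  then obtain u where u: "u \<in> carrier M" "b = u \<otimes> a" by blast
  show "carrier M #> b \<subseteq> carrier M #> a"
  proof
    fix z assume "z \<in> carrier M #> b"
    then obtain m where m: "m \<in> carrier M" "z = m \<otimes> b" by (auto simp: r_coset_def)
    then have "z = (m \<otimes> u) \<otimes> a" using u assms(1) by (simp add: m_assoc)
    moreover have "m \<otimes> u \<in> carrier M" using m(1) u(1) by simp
    ultimately show "z \<in> carrier M #> a" unfolding r_coset_def by blast
  qed
qed

lemma right_ideal_subset_iff:
  assumes "a \<in> carrier M" "b \<in> carrier M"
  shows "b <# carrier M \<subseteq> a <# carrier M \<longleftrightarrow> (\<exists>u\<in>carrier M. b = a \<otimes> u)"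
proof
  assume "b <# carrier M \<subseteq> a <# carrier M"
  moreover have "b \<in> b <# carrier M" using assms by (auto simp: l_coset_def intro!: bexI[of _ \<one>])
  ultimately show "\<exists>u\<in>carrier M. b = a \<otimes> u" by (auto simp: l_coset_def)
next
  assume "\<exists>u\<in>carrier M. b = a \<otimes> u"
  then obtain u where u: "u \<in> carrier M" "b = a \<otimes> u" by blast
  show "b <# carrier M \<subseteq> a <# carrier M"
  proof
    fix z assume "z \<in> b <# carrier M"
    then obtain m where m: "m \<in> carrier M" "z = b \<otimes> m" by (auto simp: l_coset_def)
    then have "z = a \<otimes> (u \<otimes> m)" using u assms(1) by (simp add: m_assoc)
    moreover have "u \<otimes> m \<in> carrier M" using m(1) u(1) by simp
    ultimately show "z \<in> a <# carrier M" unfolding l_coset_def by blast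
  qed
qed

lemma two_sided_ideal_subset_iff:
  assumes "a \<in> carrier M" "b \<in> carrier M"
  shows "(carrier M #> b) <#> carrier M \<subseteq> (carrier M #> a) <#> carrier M \<longleftrightarrow>
    (\<exists>u\<in>carrier M. \<exists>v\<in>carrier M. b = u \<otimes> a \<otimes> v)"
proof
  assume "(carrier M #> b) <#> carrier M \<subseteq> (carrier M #> a) <#> carrier M"
  moreover have "\<one> \<otimes> b \<otimes> \<one> \<in> (carrier M #> b) <#> carrier M"
    unfolding r_coset_def set_mult_def by blast
  then have "b \<in> (carrier M #> b) <#> carrier M" using assms by simp
  ultimately show "\<exists>u\<in>carrier M. \<exists>v\<in>carrier M. b = u \<otimes> a \<otimes> v"
    unfolding r_coset_def set_mult_def by blast
next
  assume "\<exists>u\<in>carrier M. \<exists>v\<in>carrier M. b = u \<otimes> a \<otimes> v"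
  then obtain u v where uv: "u \<in> carrier M" "v \<in> carrier M" "b = u \<otimes> a \<otimes> v" by auto
  show "(carrier M #> b) <#> carrier M \<subseteq> (carrier M #> a) <#> carrier M"
  proof
    fix z assume "z \<in> (carrier M #> b) <#> carrier M"
    then obtain p q where pq: "p \<in> carrier M" "q \<in> carrier M" "z = p \<otimes> b \<otimes> q"
      by (auto simp: r_coset_def set_mult_def)
    then have "z = (p \<otimes> u) \<otimes> a \<otimes> (v \<otimes> q)" using uv assms by (simp add: m_assoc)
    moreover have "p \<otimes> u \<in> carrier M" "v \<otimes> q \<in> carrier M" using uv pq by auto
    ultimately show "z \<in> (carrier M #> a) <#> carrier M"
      unfolding r_coset_def set_mult_def by blast
  qed
qed

lemma L_class_iff:
  assumes "a \<in> carrier M"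
  shows "b \<in> L_class M a \<longleftrightarrow>
    b \<in> carrier M \<and> (\<exists>u\<in>carrier M. b = u \<otimes> a) \<and> (\<exists>v\<in>carrier M. a = v \<otimes> b)"
  using left_ideal_subset_iff[of a b] left_ideal_subset_iff[of b a] assms
  unfolding L_class_def mem_Collect_eq set_eq_subset by metis

lemma R_class_iff:
  assumes "a \<in> carrier M"
  shows "b \<in> R_class M a \<longleftrightarrow>
    b \<in> carrier M \<and> (\<exists>u\<in>carrier M. b = a \<otimes> u) \<and> (\<exists>v\<in>carrier M. a = b \<otimes> v)"
  using right_ideal_subset_iff[of a b] right_ideal_subset_iff[of b a] assms
  unfolding R_class_def mem_Collect_eq set_eq_subset by metis

lemma J_class_iff:
  assumes "a \<in> carrier M"
  shows "b \<in> J_class M a \<longleftrightarrow> b \<in> carrier M \<and>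
    (\<exists>u\<in>carrier M. \<exists>v\<in>carrier M. b = u \<otimes> a \<otimes> v) \<and>
    (\<exists>u\<in>carrier M. \<exists>v\<in>carrier M. a = u \<otimes> b \<otimes> v)"
  using two_sided_ideal_subset_iff[of a b] two_sided_ideal_subset_iff[of b a] assms
  unfolding J_class_def mem_Collect_eq set_eq_subset by metis

lemma L_class_carrier: "x \<in> L_class M a \<Longrightarrow> x \<in> carrier M"
  and R_class_carrier: "x \<in> R_class M a \<Longrightarrow> x \<in> carrier M"
  and L_class_eq: "x \<in> L_class M a \<Longrightarrow> L_class M x = L_class M a"
  and R_class_eq: "x \<in> R_class M a \<Longrightarrow> R_class M x = R_class M a"
  and J_class_eq: "x \<in> J_class M a \<Longrightarrow> J_class M x = J_class M a"
  and L_class_self: "x \<in> carrier M \<Longrightarrow> x \<in> L_class M x"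
  and R_class_self: "x \<in> carrier M \<Longrightarrow> x \<in> R_class M x"
  by (auto simp: L_class_def R_class_def J_class_def)

lemma L_class_subset_J_class:
  assumes "a \<in> carrier M" shows "L_class M a \<subseteq> J_class M a"
  using assms by (auto simp: L_class_def J_class_def)

lemma R_class_subset_J_class:
  assumes a: "a \<in> carrier M" shows "R_class M a \<subseteq> J_class M a"
proof
  fix b assume "b \<in> R_class M a"
  then obtain u v where b: "b \<in> carrier M" and uv: "u \<in> carrier M" "v \<in> carrier M"
    and eq: "b = a \<otimes> u" "a = b \<otimes> v"
    unfolding R_class_iff[OF a] by blast
  have "b = \<one> \<otimes> a \<otimes> u" using eq(1) a by simp
  moreover have "a = \<one> \<otimes> b \<otimes> v" using eq(2) b by simp
  ultimately show "b \<in> J_class M a" using b uv one_closed unfolding J_class_iff[OF a] by blast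
qed

text \<open>Stability: if \<open>x = p u x q\<close>, then right multiplication by \<open>q\<close> maps \<open>M p u x\<close> onto
  \<open>M x\<close>, so the ideal \<open>M u x\<close>, which contains \<open>M p u x\<close> and is contained in \<open>M x\<close>, is at least as
  large as \<open>M x\<close>; in a finite monoid the two coincide.\<close>

lemma left_stable:
  assumes c: "x \<in> carrier M" "u \<in> carrier M" "p \<in> carrier M" "q \<in> carrier M"
    and x: "x = p \<otimes> (u \<otimes> x) \<otimes> q"
  shows "u \<otimes> x \<in> L_class M x"
proof -
  have fin: "finite (carrier M #> y)" for y
    using finite_carrier by (simp add: r_coset_def)
  have sub: "carrier M #> (u \<otimes> x) \<subseteq> carrier M #> x"
    using c by (subst left_ideal_subset_iff) auto
  have "carrier M #> x \<subseteq> (\<lambda>z. z \<otimes> q) ` (carrier M #> (u \<otimes> x))"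
  proof
    fix z assume "z \<in> carrier M #> x"
    then obtain m where m: "m \<in> carrier M" "z = m \<otimes> x" by (auto simp: r_coset_def)
    have "z = (m \<otimes> p) \<otimes> (u \<otimes> x) \<otimes> q"
      using m c by (subst (asm) x) (simp add: m_assoc)
    moreover have "m \<otimes> p \<in> carrier M" using m c by simp
    ultimately show "z \<in> (\<lambda>z. z \<otimes> q) ` (carrier M #> (u \<otimes> x))"
      unfolding r_coset_def by blast
  qed
  then have "card (carrier M #> x) \<le> card (carrier M #> (u \<otimes> x))"
    using fin surj_card_le by blast
  with sub fin have "carrier M #> (u \<otimes> x) = carrier M #> x"
    by (meson card_seteq)
  then show ?thesis using c by (simp add: L_class_def)
qed

lemma right_stable:
  assumes c: "x \<in> carrier M" "u \<in> carrier M" "p \<in> carrier M" "q \<in> carrier M"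
    and x: "x = p \<otimes> (x \<otimes> u) \<otimes> q"
  shows "x \<otimes> u \<in> R_class M x"
proof -
  have fin: "finite (y <# carrier M)" for y
    using finite_carrier by (simp add: l_coset_def)
  have sub: "(x \<otimes> u) <# carrier M \<subseteq> x <# carrier M"
    using c by (subst right_ideal_subset_iff) auto
  have "x <# carrier M \<subseteq> (\<lambda>z. p \<otimes> z) ` ((x \<otimes> u) <# carrier M)"
  proof
    fix z assume "z \<in> x <# carrier M"
    then obtain m where m: "m \<in> carrier M" "z = x \<otimes> m" by (auto simp: l_coset_def)
    have "z = p \<otimes> ((x \<otimes> u) \<otimes> (q \<otimes> m))"
      using m c by (subst (asm) x) (simp add: m_assoc)
    moreover have "q \<otimes> m \<in> carrier M" using m c by simp
    ultimately show "z \<in> (\<lambda>z. p \<otimes> z) ` ((x \<otimes> u) <# carrier M)"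
      unfolding l_coset_def by blast
  qed
  then have "card (x <# carrier M) \<le> card ((x \<otimes> u) <# carrier M)"
    using fin surj_card_le by blast
  with sub fin have "(x \<otimes> u) <# carrier M = x <# carrier M"
    by (meson card_seteq)
  then show ?thesis using c by (simp add: R_class_def)
qed

text \<open>Multiplying \<open>x\<close> on the left a priori leaves the \<open>\<L>\<close>-class of \<open>x\<close>; a right multiplier leading
  back to \<open>x\<close> is enough for stability to exclude this.\<close>

lemma left_mult_R_L:
  assumes "x \<in> carrier M" "u \<in> carrier M" "u \<otimes> x \<in> R_class M x"
  shows "u \<otimes> x \<in> L_class M x"
proof -
  obtain q where "q \<in> carrier M" "x = u \<otimes> x \<otimes> q"
    using assms by (auto simp: R_class_iff)
  then show ?thesis using assms by (intro left_stable[of x u \<one> q]) simp_all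
qed

lemma right_mult_L_R:
  assumes "x \<in> carrier M" "u \<in> carrier M" "x \<otimes> u \<in> L_class M x"
  shows "x \<otimes> u \<in> R_class M x"
proof -
  obtain p where "p \<in> carrier M" "x = p \<otimes> (x \<otimes> u)"
    using assms by (auto simp: L_class_iff)
  then show ?thesis using assms by (intro right_stable[of x u p \<one>]) simp_all
qed

text \<open>Left multiplication respects \<open>\<R>\<close>, so one element that stays in its \<open>\<R>\<close>-class forces the
  class into itself; by stability the multiplication can be undone, hence it permutes the class.\<close>

lemma left_mult_R_class:
  assumes c: "x \<in> carrier M" "u \<in> carrier M" and ux: "u \<otimes> x \<in> R_class M x"
  shows "u <# R_class M x = R_class M x"
proof -
  have "u \<otimes> x \<in> L_class M x" using left_mult_R_L c ux .
  then obtain v where v: "v \<in> carrier M" "x = v \<otimes> (u \<otimes> x)" using c by (auto simp: L_class_iff)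
  have fin: "finite (R_class M x)"
    using finite_carrier by (rule rev_finite_subset) (auto simp: R_class_def)
  have inj: "inj_on (\<lambda>y. u \<otimes> y) (R_class M x)"
  proof (rule inj_on_inverseI)
    fix y assume "y \<in> R_class M x"
    then obtain q where "q \<in> carrier M" "y = x \<otimes> q" using c by (auto simp: R_class_iff)
    then show "v \<otimes> (u \<otimes> y) = y" using c v by (simp flip: m_assoc)
  qed
  have sub: "(\<lambda>y. u \<otimes> y) ` R_class M x \<subseteq> R_class M x"
  proof
    fix z assume "z \<in> (\<lambda>y. u \<otimes> y) ` R_class M x"
    then obtain y where zy: "z = u \<otimes> y" "y \<in> R_class M x" by blast
    then obtain p q where y: "y \<in> carrier M" "p \<in> carrier M" "q \<in> carrier M"
      "y = x \<otimes> p" "x = y \<otimes> q" unfolding R_class_iff[OF c(1)] by blast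
    have "u \<otimes> y = u \<otimes> x \<otimes> p" using y(4) y(2) c by (simp add: m_assoc)
    moreover have "u \<otimes> x = u \<otimes> y \<otimes> q" using y(1,3,5) c by (simp add: m_assoc)
    ultimately have "u \<otimes> y \<in> R_class M (u \<otimes> x)"
      using R_class_iff[of "u \<otimes> x" "u \<otimes> y"] c y(1,2,3) by blast
    then show "z \<in> R_class M x" using R_class_eq[OF ux] zy(1) by simp
  qed
  have "(\<lambda>y. u \<otimes> y) ` R_class M x = R_class M x"
    using endo_inj_surj[OF fin sub inj] .
  then show ?thesis by (auto simp: l_coset_def)
qed

lemma right_mult_L_class:
  assumes c: "x \<in> carrier M" "u \<in> carrier M" and xu: "x \<otimes> u \<in> L_class M x"
  shows "L_class M x #> u = L_class M x"
proof -
  have "x \<otimes> u \<in> R_class M x" using right_mult_L_R c xu .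
  then obtain v where v: "v \<in> carrier M" "x = x \<otimes> u \<otimes> v" using c by (auto simp: R_class_iff)
  have fin: "finite (L_class M x)"
    using finite_carrier by (rule rev_finite_subset) (auto simp: L_class_def)
  have inj: "inj_on (\<lambda>y. y \<otimes> u) (L_class M x)"
  proof (rule inj_on_inverseI)
    fix y assume "y \<in> L_class M x"
    then obtain q where q: "q \<in> carrier M" "y = q \<otimes> x" using c by (auto simp: L_class_iff)
    have "q \<otimes> x \<otimes> u \<otimes> v = q \<otimes> (x \<otimes> u \<otimes> v)" using c v(1) q(1) by (simp add: m_assoc)
    then show "y \<otimes> u \<otimes> v = y" using v(2) q(2) by simp
  qed
  have sub: "(\<lambda>y. y \<otimes> u) ` L_class M x \<subseteq> L_class M x"
  proof
    fix z assume "z \<in> (\<lambda>y. y \<otimes> u) ` L_class M x"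
    then obtain y where zy: "z = y \<otimes> u" "y \<in> L_class M x" by blast
    then obtain p q where y: "y \<in> carrier M" "p \<in> carrier M" "q \<in> carrier M"
      "y = p \<otimes> x" "x = q \<otimes> y" unfolding L_class_iff[OF c(1)] by blast
    have "y \<otimes> u = p \<otimes> (x \<otimes> u)" using y(4) y(2) c by (simp add: m_assoc)
    moreover have "x \<otimes> u = q \<otimes> (y \<otimes> u)" using y(1,3,5) c by (simp flip: m_assoc)
    ultimately have "y \<otimes> u \<in> L_class M (x \<otimes> u)"
      using L_class_iff[of "x \<otimes> u" "y \<otimes> u"] c y(1,2,3) by blast
    then show "z \<in> L_class M x" using L_class_eq[OF xu] zy(1) by simp
  qed
  have "(\<lambda>y. y \<otimes> u) ` L_class M x = L_class M x"
    using endo_inj_surj[OF fin sub inj] .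
  then show ?thesis by (auto simp: r_coset_def)
qed

text \<open>Green's lemma. Since \<open>x = l' (l x)\<close>, the elements \<open>x\<close> and \<open>l x\<close> generate the same left
  ideal, so a left Green pair moves \<open>\<R>\<close>-classes while preserving \<open>\<L>\<close>-classes.\<close>

lemma left_Green_pair_bij:
  assumes gp: "left_Green_pair M R R' l l'" and R: "R \<subseteq> carrier M"
    and L: "L \<in> L_classes M"
  shows "bij_betw (\<lambda>x. l \<otimes> x) (R \<inter> L) (R' \<inter> L)" "bij_betw (\<lambda>x. l' \<otimes> x) (R' \<inter> L) (R \<inter> L)"
proof -
  have c: "l \<in> carrier M" "l' \<in> carrier M" and RR': "l <# R = R'" "l' <# R' = R"
    using gp by (auto simp: left_Green_pair_def)
  have R': "R' \<subseteq> carrier M" using RR'(1) R c by (auto simp: l_coset_def)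
  have inv: "x \<in> R \<Longrightarrow> l' \<otimes> (l \<otimes> x) = x" "y \<in> R' \<Longrightarrow> l \<otimes> (l' \<otimes> y) = y" for x y
    using gp R R' c by (auto simp: left_Green_pair_def subset_eq simp flip: m_assoc)
  obtain z where z: "L = L_class M z" using L by (auto simp: L_classes_def)
  have step: "m \<otimes> x \<in> L" if "m \<in> carrier M" "m' \<in> carrier M" "m' \<otimes> (m \<otimes> x) = x" "x \<in> L" for m m' x
  proof -
    have x: "x \<in> carrier M" using that(4) z by (simp add: L_class_carrier)
    have "m \<otimes> x \<in> L_class M x" using that x L_class_iff[OF x] by (metis m_closed)
    then show ?thesis using L_class_eq that(4) z by metis
  qed
  have 1: "l \<otimes> x \<in> R' \<inter> L" if "x \<in> R \<inter> L" for x
    using that step[of l l' x] inv(1) c RR'(1) by (auto simp: l_coset_def)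
  have 2: "l' \<otimes> y \<in> R \<inter> L" if "y \<in> R' \<inter> L" for y
    using that step[of l' l y] inv(2) c RR'(2) by (auto simp: l_coset_def)
  show "bij_betw (\<lambda>x. l \<otimes> x) (R \<inter> L) (R' \<inter> L)"
    by (rule bij_betwI[where g = "\<lambda>x. l' \<otimes> x"]) (use 1 2 inv in auto)
  show "bij_betw (\<lambda>x. l' \<otimes> x) (R' \<inter> L) (R \<inter> L)"
    by (rule bij_betwI[where g = "\<lambda>x. l \<otimes> x"]) (use 1 2 inv in auto)
qed

lemma right_Green_pair_bij:
  assumes gp: "right_Green_pair M L L' r r'" and R: "R \<in> R_classes M"
  shows "bij_betw (\<lambda>x. x \<otimes> r) (R \<inter> L) (R \<inter> L')" "bij_betw (\<lambda>x. x \<otimes> r') (R \<inter> L') (R \<inter> L)"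
proof -
  have c: "r \<in> carrier M" "r' \<in> carrier M" and LL': "L #> r = L'" "L' #> r' = L"
    and inv: "x \<in> L \<Longrightarrow> x \<otimes> r \<otimes> r' = x" "y \<in> L' \<Longrightarrow> y \<otimes> r' \<otimes> r = y" for x y
    using gp by (auto simp: right_Green_pair_def)
  obtain z where z: "R = R_class M z" using R by (auto simp: R_classes_def)
  have step: "x \<otimes> m \<in> R" if "m \<in> carrier M" "m' \<in> carrier M" "x \<otimes> m \<otimes> m' = x" "x \<in> R" for m m' x
  proof -
    have x: "x \<in> carrier M" using that(4) z by (simp add: R_class_carrier)
    have "x \<otimes> m \<in> R_class M x" using that x R_class_iff[OF x] by (metis m_closed)
    then show ?thesis using R_class_eq that(4) z by metis
  qed
  have 1: "x \<otimes> r \<in> R \<inter> L'" if "x \<in> R \<inter> L" for x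
    using that step[of r r' x] inv(1) c LL'(1) by (auto simp: r_coset_def)
  have 2: "y \<otimes> r' \<in> R \<inter> L" if "y \<in> R \<inter> L'" for y
    using that step[of r' r y] inv(2) c LL'(2) by (auto simp: r_coset_def)
  show "bij_betw (\<lambda>x. x \<otimes> r) (R \<inter> L) (R \<inter> L')"
    by (rule bij_betwI[where g = "\<lambda>x. x \<otimes> r'"]) (use 1 2 inv in auto)
  show "bij_betw (\<lambda>x. x \<otimes> r') (R \<inter> L') (R \<inter> L)"
    by (rule bij_betwI[where g = "\<lambda>x. x \<otimes> r"]) (use 1 2 inv in auto)
qed


section \<open>The right Schuetzenberger group acts freely and transitively\<close>

lemma H_class_carrier: "x \<in> H_class M a \<Longrightarrow> x \<in> carrier M"
  by (auto simp: H_class_def L_class_def)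

text \<open>Every element of \<open>H\<close> is a left multiple \<open>u a\<close> of \<open>a\<close>, and left and right multiplications
  commute, so a right multiplication on \<open>H\<close> is determined by its value at \<open>a\<close>.\<close>

lemma right_mult_map_cong:
  assumes a: "a \<in> carrier M" and mn: "m \<in> carrier M" "n \<in> carrier M" and eq: "a \<otimes> m = a \<otimes> n"
  shows "right_mult_map M (H_class M a) m = right_mult_map M (H_class M a) n"
  unfolding right_mult_map_def
proof (rule restrict_ext)
  fix x assume "x \<in> H_class M a"
  then obtain u where "u \<in> carrier M" "x = u \<otimes> a"
    using a by (auto simp: H_class_def L_class_iff)
  then show "x \<otimes> m = x \<otimes> n" using a mn eq by (simp add: m_assoc)
qed

text \<open>One value decides whether \<open>m\<close> acts on the whole of \<open>H\<close>. Stability keeps \<open>x m\<close> in the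
  \<open>\<R>\<close>-class once it is in the \<open>\<L>\<close>-class, and a multiplier undoing \<open>m\<close> at \<open>a\<close> undoes it on all
  left multiples of \<open>a\<close>, so \<open>m\<close> permutes the finite set \<open>H\<close>.\<close>

lemma right_mult_map_in_schutz:
  assumes a: "a \<in> carrier M" and m: "m \<in> carrier M" and am: "a \<otimes> m \<in> H_class M a"
  shows "right_mult_map M (H_class M a) m \<in> carrier (right_schutz M (H_class M a))"
proof -
  let ?H = "H_class M a"
  have aL: "a \<otimes> m \<in> L_class M a" and "a \<otimes> m \<in> R_class M a" using am by (auto simp: H_class_def)
  then obtain n where n: "n \<in> carrier M" "a \<otimes> m \<otimes> n = a" using a by (auto simp: R_class_iff)
  have L: "L_class M a #> m = L_class M a" using right_mult_L_class a m aL .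
  have inv: "x \<otimes> m \<otimes> n = x" if "x \<in> ?H" for x
  proof -
    have "x \<in> L_class M a" using that by (simp add: H_class_def)
    then obtain u where u: "u \<in> carrier M" "x = u \<otimes> a"
      unfolding L_class_iff[OF a] by blast
    have "u \<otimes> a \<otimes> m \<otimes> n = u \<otimes> (a \<otimes> m \<otimes> n)" using u a m n(1) by (simp add: m_assoc)
    then show ?thesis using u n by simp
  qed
  have sub: "(\<lambda>x. x \<otimes> m) ` ?H \<subseteq> ?H"
  proof (rule image_subsetI)
    fix x assume x: "x \<in> ?H"
    then have xL: "x \<in> L_class M a" and xR: "x \<in> R_class M a" and xc: "x \<in> carrier M"
      by (auto simp: H_class_def L_class_carrier)
    have xm: "x \<otimes> m \<in> L_class M a" using L xL by (auto simp: r_coset_def)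
    then have "x \<otimes> m \<in> L_class M x" using L_class_eq[OF xL] by simp
    then have "x \<otimes> m \<in> R_class M x" using right_mult_L_R xc m by blast
    then show "x \<otimes> m \<in> ?H" using xm R_class_eq[OF xR] by (simp add: H_class_def)
  qed
  have "finite ?H" using finite_carrier H_class_carrier by (meson finite_subset subsetI)
  moreover have "inj_on (\<lambda>x. x \<otimes> m) ?H" using inv by (rule inj_on_inverseI)
  ultimately have "(\<lambda>x. x \<otimes> m) ` ?H = ?H" using sub endo_inj_surj by blast
  then have "?H #> m = ?H" by (auto simp: r_coset_def)
  then show ?thesis using m by (auto simp: right_schutz_def)
qed

lemma right_schutzE:
  assumes "f \<in> carrier (right_schutz M H)"
  obtains m where "m \<in> carrier M" "H #> m = H" "f = right_mult_map M H m"
    "\<And>x. x \<in> H \<Longrightarrow> f x = x \<otimes> m" "\<And>x. x \<in> H \<Longrightarrow> f x \<in> H"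
proof -
  obtain m where m: "m \<in> carrier M" "H #> m = H" "f = right_mult_map M H m"
    using assms by (auto simp: right_schutz_def)
  then have "x \<otimes> m \<in> H" if "x \<in> H" for x using that by (auto simp: r_coset_def)
  with m that show ?thesis by (auto simp: right_mult_map_def)
qed

lemma schutz_free:
  assumes a: "a \<in> carrier M"
    and fg: "f \<in> carrier (right_schutz M (H_class M a))" "g \<in> carrier (right_schutz M (H_class M a))"
    and eq: "f a = g a"
  shows "f = g"
proof -
  have aH: "a \<in> H_class M a" using a by (simp add: H_class_def L_class_self R_class_self)
  obtain m where m: "m \<in> carrier M" "f = right_mult_map M (H_class M a) m" "f a = a \<otimes> m"
    using fg(1) aH by (auto elim!: right_schutzE)
  obtain n where n: "n \<in> carrier M" "g = right_mult_map M (H_class M a) n" "g a = a \<otimes> n"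
    using fg(2) aH by (auto elim!: right_schutzE)
  show ?thesis using right_mult_map_cong[OF a m(1) n(1)] m n eq by simp
qed

lemma schutz_transitive:
  assumes a: "a \<in> carrier M" and b: "b \<in> H_class M a"
  shows "\<exists>f \<in> carrier (right_schutz M (H_class M a)). f a = b"
proof -
  have aH: "a \<in> H_class M a" using a by (simp add: H_class_def L_class_self R_class_self)
  obtain m where m: "m \<in> carrier M" "b = a \<otimes> m"
    using a b by (auto simp: H_class_def R_class_iff)
  have "right_mult_map M (H_class M a) m \<in> carrier (right_schutz M (H_class M a))"
    using right_mult_map_in_schutz a m b by simp
  moreover have "right_mult_map M (H_class M a) m a = b"
    using aH m by (simp add: right_mult_map_def)
  ultimately show ?thesis by blast
qed

lemma bij_betw_schutz_eval:
  assumes a: "a \<in> carrier M"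
  shows "bij_betw (\<lambda>f. f a) (carrier (right_schutz M (H_class M a))) (H_class M a)"
proof (rule bij_betw_imageI)
  have aH: "a \<in> H_class M a" using a by (simp add: H_class_def L_class_self R_class_self)
  show "inj_on (\<lambda>f. f a) (carrier (right_schutz M (H_class M a)))"
    using schutz_free[OF a] by (auto intro: inj_onI)
  show "(\<lambda>f. f a) ` carrier (right_schutz M (H_class M a)) = H_class M a"
    using schutz_transitive[OF a] aH by (auto elim: right_schutzE)
qed

lemma finite_schutz: "finite (carrier (right_schutz M H))"
  using finite_carrier by (simp add: right_schutz_def)

lemma schutz_mult_apply:
  "x \<in> H \<Longrightarrow> (f \<otimes>\<^bsub>right_schutz M H\<^esub> g) x = f (g x)"
  by (simp add: right_schutz_def compose_def)

text \<open>By freeness, the group laws need to be checked at \<open>a\<close> only.\<close>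

lemma group_schutz:
  assumes a: "a \<in> carrier M"
  shows "group (right_schutz M (H_class M a))"
proof -
  let ?H = "H_class M a" and ?G = "right_schutz M (H_class M a)"
  have aH: "a \<in> ?H" using a by (simp add: H_class_def L_class_self R_class_self)
  have one: "\<one>\<^bsub>?G\<^esub> = right_mult_map M ?H \<one>"
    by (auto simp: right_schutz_def right_mult_map_def H_class_carrier intro!: restrict_ext)
  have one_apply: "\<one>\<^bsub>?G\<^esub> x = x" if "x \<in> ?H" for x
    using that by (simp add: right_schutz_def)
  have closed: "f \<otimes>\<^bsub>?G\<^esub> g \<in> carrier ?G" if fg: "f \<in> carrier ?G" "g \<in> carrier ?G" for f g
  proof -
    from fg(1) obtain m where m: "m \<in> carrier M" "\<And>x. x \<in> ?H \<Longrightarrow> f x = x \<otimes> m"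
      "\<And>x. x \<in> ?H \<Longrightarrow> f x \<in> ?H" by (auto elim!: right_schutzE)
    from fg(2) obtain n where n: "n \<in> carrier M" "\<And>x. x \<in> ?H \<Longrightarrow> g x = x \<otimes> n"
      "\<And>x. x \<in> ?H \<Longrightarrow> g x \<in> ?H" by (auto elim!: right_schutzE)
    have val: "f (g x) = x \<otimes> (n \<otimes> m)" if "x \<in> ?H" for x
      using m(1) m(2)[OF n(3)[OF that]] n(1) n(2)[OF that] H_class_carrier[OF that] by (simp add: m_assoc)
    have "f \<otimes>\<^bsub>?G\<^esub> g = right_mult_map M ?H (n \<otimes> m)"
      unfolding right_mult_map_def right_schutz_def compose_def
      by (auto intro!: restrict_ext simp: val)
    moreover have "a \<otimes> (n \<otimes> m) \<in> ?H" using val[OF aH] m(3)[OF n(3)[OF aH]] by simp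
    ultimately show ?thesis using right_mult_map_in_schutz a m(1) n(1) by simp
  qed
  have onec: "\<one>\<^bsub>?G\<^esub> \<in> carrier ?G"
    unfolding one using right_mult_map_in_schutz a aH by simp
  show ?thesis
  proof (rule groupI)
    fix f g k
    assume fgk: "f \<in> carrier ?G" "g \<in> carrier ?G" "k \<in> carrier ?G"
    have "g a \<in> ?H" "k a \<in> ?H" "g (k a) \<in> ?H" using fgk aH by (meson right_schutzE)+
    then show "f \<otimes>\<^bsub>?G\<^esub> g \<otimes>\<^bsub>?G\<^esub> k = f \<otimes>\<^bsub>?G\<^esub> (g \<otimes>\<^bsub>?G\<^esub> k)"
      using fgk aH closed by (intro schutz_free[OF a]) (simp_all add: schutz_mult_apply)
  next
    fix f assume f: "f \<in> carrier ?G"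
    have fa: "f a \<in> ?H" using f aH by (meson right_schutzE)
    show "\<one>\<^bsub>?G\<^esub> \<otimes>\<^bsub>?G\<^esub> f = f"
      using f fa aH closed onec
      by (intro schutz_free[OF a]) (simp_all add: schutz_mult_apply one_apply)
    \<comment> \<open>The H-class of \<open>f a\<close> is again \<open>H\<close>, so transitivity from \<open>f a\<close> supplies a map back to \<open>a\<close>.\<close>
    have same: "H_class M (f a) = ?H"
      using fa L_class_eq R_class_eq by (auto simp: H_class_def)
    have "\<exists>g \<in> carrier ?G. g (f a) = a"
      using schutz_transitive[OF H_class_carrier[OF fa], of a] aH unfolding same by simp
    then obtain g where g: "g \<in> carrier ?G" "g (f a) = a" by blast
    have "g \<otimes>\<^bsub>?G\<^esub> f = \<one>\<^bsub>?G\<^esub>"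
      using closed[OF g(1) f] onec g aH
      by (intro schutz_free[OF a]) (simp_all add: schutz_mult_apply one_apply)
    with g(1) show "\<exists>g \<in> carrier ?G. g \<otimes>\<^bsub>?G\<^esub> f = \<one>\<^bsub>?G\<^esub>" by blast
  qed (use closed onec in auto)
qed

lemma tau_schutz:
  assumes a: "a \<in> carrier M" and g: "g a \<in> H_class M a"
  shows "tau M a g \<in> carrier (right_schutz M (H_class M a))" "tau M a g a = g a"
proof -
  have "\<exists>!f. f \<in> carrier (right_schutz M (H_class M a)) \<and> g a = f a"
    using schutz_transitive[OF a g] schutz_free[OF a] by metis
  from theI'[OF this]
  show "tau M a g \<in> carrier (right_schutz M (H_class M a))" "tau M a g a = g a"
    unfolding tau_def by simp_all
qed


section \<open>Fixed points inside one H-class\<close>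

text \<open>This places \<open>l' h l\<close> in the domain of \<open>\<tau>\<close>. Since \<open>h\<close> preserves \<open>R\<close>, stability makes it preserve
  \<open>\<L>\<close>-classes on \<open>R\<close>, as the Green pair does on both sides.\<close>

lemma left_Green_conj_in_H:
  assumes a: "a \<in> carrier M" and R: "R \<in> R_classes M" and h: "h \<in> carrier M" "h <# R = R"
    and gp: "left_Green_pair M (R_class M a) R l l'"
  shows "l' \<otimes> h \<otimes> l \<otimes> a \<in> H_class M a"
proof -
  have c: "l \<in> carrier M" "l' \<in> carrier M" using gp by (auto simp: left_Green_pair_def)
  have Lc: "L_class M a \<in> L_classes M" using a by (simp add: L_classes_def)
  have R0: "R_class M a \<subseteq> carrier M" by (auto simp: R_class_carrier)
  note bij = left_Green_pair_bij[OF gp R0 Lc]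
  have "a \<in> R_class M a \<inter> L_class M a" using a by (simp add: L_class_self R_class_self)
  then have la: "l \<otimes> a \<in> R \<inter> L_class M a" using bij_betw_apply[OF bij(1)] by blast
  then have hla: "h \<otimes> (l \<otimes> a) \<in> R" using h(2) by (auto simp: l_coset_def)
  obtain z where "R = R_class M z" using R by (auto simp: R_classes_def)
  then have "R_class M (l \<otimes> a) = R" using la R_class_eq by blast
  then have "h \<otimes> (l \<otimes> a) \<in> L_class M (l \<otimes> a)"
    using left_mult_R_L[of "l \<otimes> a" h] hla a c h(1) by simp
  then have "h \<otimes> (l \<otimes> a) \<in> R \<inter> L_class M a" using hla la L_class_eq by blast
  then have "l' \<otimes> (h \<otimes> (l \<otimes> a)) \<in> R_class M a \<inter> L_class M a"
    using bij_betw_apply[OF bij(2)] by blast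
  then show ?thesis using a h c by (simp add: H_class_def m_assoc Int_commute)
qed

lemma right_Green_conj_in_H:
  assumes a: "a \<in> carrier M" and L: "L \<in> L_classes M" and k: "k \<in> carrier M" "L #> k = L"
    and gp: "right_Green_pair M (L_class M a) L r r'"
  shows "a \<otimes> (r \<otimes> k \<otimes> r') \<in> H_class M a"
proof -
  have c: "r \<in> carrier M" "r' \<in> carrier M" using gp by (auto simp: right_Green_pair_def)
  have Rc: "R_class M a \<in> R_classes M" using a by (simp add: R_classes_def)
  note bij = right_Green_pair_bij[OF gp Rc]
  have "a \<in> R_class M a \<inter> L_class M a" using a by (simp add: L_class_self R_class_self)
  then have ar: "a \<otimes> r \<in> R_class M a \<inter> L" using bij_betw_apply[OF bij(1)] by blast
  then have ark: "a \<otimes> r \<otimes> k \<in> L" using k(2) by (auto simp: r_coset_def)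
  obtain z where "L = L_class M z" using L by (auto simp: L_classes_def)
  then have "L_class M (a \<otimes> r) = L" using ar L_class_eq by blast
  then have "a \<otimes> r \<otimes> k \<in> R_class M (a \<otimes> r)"
    using right_mult_L_R[of "a \<otimes> r" k] ark a c k(1) by simp
  then have "a \<otimes> r \<otimes> k \<in> R_class M a \<inter> L" using ark ar R_class_eq by blast
  then have "a \<otimes> r \<otimes> k \<otimes> r' \<in> R_class M a \<inter> L_class M a"
    using bij_betw_apply[OF bij(2)] by blast
  then show ?thesis using a k c by (simp add: H_class_def m_assoc Int_commute)
qed

text \<open>An element of \<open>R \<inter> L\<close> is \<open>l x r\<close> for a unique \<open>x\<close> in \<open>H\<close>, and it is fixed iff
  \<open>(l' h l) x (r k r') = x\<close>. Writing \<open>x = f a\<close> with \<open>f\<close> in \<open>\<Gamma>'(H)\<close> and letting the left factor act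
  through \<open>\<tau>\<close>, this reads \<open>b f t = f\<close>, that is, \<open>f\<close> conjugates \<open>t\<inverse>\<close> into \<open>b\<close>.\<close>

lemma card_fixed_in_class:
  fixes a h k l l' r r' :: 'a and R L :: "'a set"
  defines "H \<equiv> H_class M a"
  defines "G \<equiv> right_schutz M H"
  assumes a: "a \<in> carrier M"
    and R: "R \<in> R_classes M" and h: "h \<in> carrier M" "h <# R = R"
    and L: "L \<in> L_classes M" and k: "k \<in> carrier M" "L #> k = L"
    and gpl: "left_Green_pair M (R_class M a) R l l'"
    and gpr: "right_Green_pair M (L_class M a) L r r'"
  shows "card {s \<in> R \<inter> L. h \<otimes> s \<otimes> k = s} =
    card {f \<in> carrier G. f \<otimes>\<^bsub>G\<^esub> inv\<^bsub>G\<^esub> (tau M a (left_mult_map M H (l' \<otimes> h \<otimes> l))) \<otimes>\<^bsub>G\<^esub> inv\<^bsub>G\<^esub> f =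
      right_mult_map M H (r \<otimes> k \<otimes> r')}"
proof -
  interpret G: group G unfolding G_def H_def using group_schutz[OF a] .
  define w where "w = l' \<otimes> h \<otimes> l"
  define t where "t = tau M a (left_mult_map M H w)"
  define b where "b = right_mult_map M H (r \<otimes> k \<otimes> r')"
  have cl: "l \<in> carrier M" "l' \<in> carrier M" using gpl by (auto simp: left_Green_pair_def)
  have cr: "r \<in> carrier M" "r' \<in> carrier M" using gpr by (auto simp: right_Green_pair_def)
  have wc: "w \<in> carrier M" using cl h by (simp add: w_def)
  have aH: "a \<in> H" using a by (simp add: H_def H_class_def L_class_self R_class_self)
  have HRL: "H = R_class M a \<inter> L_class M a" by (auto simp: H_def H_class_def)
  have Hc: "x \<in> carrier M" if "x \<in> H" for x using that by (simp add: H_def H_class_carrier)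
  have wa: "left_mult_map M H w a = w \<otimes> a" using aH by (simp add: left_mult_map_def)
  have waH: "w \<otimes> a \<in> H" unfolding w_def H_def using left_Green_conj_in_H[OF a R h gpl] .
  have t: "t \<in> carrier G" "t a = w \<otimes> a"
    using tau_schutz[OF a, of "left_mult_map M H w"] waH wa by (simp_all add: t_def G_def H_def)
  have b: "b \<in> carrier G"
    unfolding b_def G_def H_def
    using right_mult_map_in_schutz[OF a _ right_Green_conj_in_H[OF a L k gpr]] cr k by simp
  have bx: "b x = x \<otimes> (r \<otimes> k \<otimes> r')" if "x \<in> H" for x
    using that by (simp add: b_def right_mult_map_def)
  have GH: "f x \<in> H" if "f \<in> carrier G" "x \<in> H" for f x
    using that unfolding G_def by (meson right_schutzE)
  have Gmult: "(f \<otimes>\<^bsub>G\<^esub> g) x = f (g x)" if "x \<in> H" for f g x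
    using that unfolding G_def by (rule schutz_mult_apply)
  have Lc: "L_class M a \<in> L_classes M" using a by (simp add: L_classes_def)
  have R0: "R_class M a \<subseteq> carrier M" by (auto simp: R_class_carrier)
  have "bij_betw (\<lambda>x. l \<otimes> x) H (R \<inter> L_class M a)"
    using left_Green_pair_bij(1)[OF gpl R0 Lc] by (simp add: HRL)
  from bij_betw_trans[OF this right_Green_pair_bij(1)[OF gpr R]]
  have bij: "bij_betw (\<lambda>x. l \<otimes> x \<otimes> r) H (R \<inter> L)" by (simp add: comp_def)
  have "bij_betw (\<lambda>f. f a) (carrier G) H"
    unfolding G_def H_def using bij_betw_schutz_eval[OF a] .
  from bij_betw_trans[OF this bij]
  have bijG: "bij_betw (\<lambda>f. l \<otimes> f a \<otimes> r) (carrier G) (R \<inter> L)" by (simp add: comp_def)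

  have fixed_H: "h \<otimes> (l \<otimes> x \<otimes> r) \<otimes> k = l \<otimes> x \<otimes> r \<longleftrightarrow> w \<otimes> x \<otimes> (r \<otimes> k \<otimes> r') = x"
    if x: "x \<in> H" for x
  proof -
    have xc: "x \<in> carrier M" and xR: "x \<in> R_class M a" and xL: "x \<in> L_class M a"
      using x Hc HRL by auto
    have "l \<otimes> x \<in> R" using xR gpl by (auto simp: left_Green_pair_def l_coset_def)
    then have "h \<otimes> (l \<otimes> x) \<in> R" using h(2) by (auto simp: l_coset_def)
    then have ll': "l \<otimes> l' \<otimes> (h \<otimes> (l \<otimes> x)) = h \<otimes> (l \<otimes> x)"
      using gpl by (simp add: left_Green_pair_def)
    have "x \<otimes> r \<in> L" using xL gpr by (auto simp: right_Green_pair_def r_coset_def)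
    then have "x \<otimes> r \<otimes> k \<in> L" using k(2) by (auto simp: r_coset_def)
    then have rr': "x \<otimes> r \<otimes> k \<otimes> r' \<otimes> r = x \<otimes> r \<otimes> k"
      using gpr by (simp add: right_Green_pair_def)
    have l'l: "l' \<otimes> l \<otimes> x = x" and r'r: "x \<otimes> r \<otimes> r' = x"
      using gpl gpr xR xL by (simp_all add: left_Green_pair_def right_Green_pair_def)
    show ?thesis
    proof
      assume eq: "h \<otimes> (l \<otimes> x \<otimes> r) \<otimes> k = l \<otimes> x \<otimes> r"
      have "w \<otimes> x \<otimes> (r \<otimes> k \<otimes> r') = l' \<otimes> (h \<otimes> (l \<otimes> x \<otimes> r) \<otimes> k) \<otimes> r'"
        using xc cl cr h k by (simp add: w_def m_assoc)
      also have "\<dots> = (l' \<otimes> l \<otimes> x) \<otimes> r \<otimes> r'"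
        unfolding eq using xc cl cr by (simp add: m_assoc)
      also have "\<dots> = x" using l'l r'r by simp
      finally show "w \<otimes> x \<otimes> (r \<otimes> k \<otimes> r') = x" .
    next
      assume eq: "w \<otimes> x \<otimes> (r \<otimes> k \<otimes> r') = x"
      have "l \<otimes> x \<otimes> r = l \<otimes> (w \<otimes> x \<otimes> (r \<otimes> k \<otimes> r')) \<otimes> r" using eq by simp
      also have "\<dots> = (l \<otimes> l' \<otimes> (h \<otimes> (l \<otimes> x))) \<otimes> (r \<otimes> k \<otimes> r' \<otimes> r)"
        using xc cl cr h k by (simp add: w_def m_assoc)
      also have "\<dots> = h \<otimes> l \<otimes> (x \<otimes> r \<otimes> k \<otimes> r' \<otimes> r)"
        unfolding ll' using xc cl cr h k by (simp add: m_assoc)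
      also have "\<dots> = h \<otimes> (l \<otimes> x \<otimes> r) \<otimes> k"
        unfolding rr' using xc cl cr h k by (simp add: m_assoc)
      finally show "h \<otimes> (l \<otimes> x \<otimes> r) \<otimes> k = l \<otimes> x \<otimes> r" by simp
    qed
  qed
  have conj: "w \<otimes> f a \<otimes> (r \<otimes> k \<otimes> r') = f a \<longleftrightarrow> f \<otimes>\<^bsub>G\<^esub> inv\<^bsub>G\<^esub> t \<otimes>\<^bsub>G\<^esub> inv\<^bsub>G\<^esub> f = b"
    if f: "f \<in> carrier G" for f
  proof -
    from f obtain m where m: "m \<in> carrier M" "\<And>x. x \<in> H \<Longrightarrow> f x = x \<otimes> m"
      unfolding G_def by (auto elim!: right_schutzE)
    have "w \<otimes> f a = f (t a)" using m aH waH t wc a by (simp add: m_assoc)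
    then have "w \<otimes> f a \<otimes> (r \<otimes> k \<otimes> r') = (b \<otimes>\<^bsub>G\<^esub> (f \<otimes>\<^bsub>G\<^esub> t)) a"
      using bx GH f t(1) aH by (simp add: Gmult)
    then have "w \<otimes> f a \<otimes> (r \<otimes> k \<otimes> r') = f a \<longleftrightarrow> b \<otimes>\<^bsub>G\<^esub> (f \<otimes>\<^bsub>G\<^esub> t) = f"
      using schutz_free[OF a] b f t(1) G.m_closed unfolding G_def H_def by metis
    also have "\<dots> \<longleftrightarrow> b = f \<otimes>\<^bsub>G\<^esub> inv\<^bsub>G\<^esub> (f \<otimes>\<^bsub>G\<^esub> t)"
      using G.inv_solve_right[of b f "f \<otimes>\<^bsub>G\<^esub> t"] b f t(1) by auto
    also have "\<dots> \<longleftrightarrow> f \<otimes>\<^bsub>G\<^esub> inv\<^bsub>G\<^esub> t \<otimes>\<^bsub>G\<^esub> inv\<^bsub>G\<^esub> f = b"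
      using f t(1) by (auto simp: G.inv_mult_group G.m_assoc)
    finally show ?thesis .
  qed
  have "bij_betw (\<lambda>f. l \<otimes> f a \<otimes> r)
      {f \<in> carrier G. f \<otimes>\<^bsub>G\<^esub> inv\<^bsub>G\<^esub> t \<otimes>\<^bsub>G\<^esub> inv\<^bsub>G\<^esub> f = b} {s \<in> R \<inter> L. h \<otimes> s \<otimes> k = s}"
  proof (rule bij_betw_subset[OF bijG])
    have "h \<otimes> (l \<otimes> f a \<otimes> r) \<otimes> k = l \<otimes> f a \<otimes> r \<longleftrightarrow> f \<otimes>\<^bsub>G\<^esub> inv\<^bsub>G\<^esub> t \<otimes>\<^bsub>G\<^esub> inv\<^bsub>G\<^esub> f = b"
      if "f \<in> carrier G" for f
      using fixed_H[OF GH[OF that aH]] conj[OF that] by simp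
    then show "(\<lambda>f. l \<otimes> f a \<otimes> r) ` {f \<in> carrier G. f \<otimes>\<^bsub>G\<^esub> inv\<^bsub>G\<^esub> t \<otimes>\<^bsub>G\<^esub> inv\<^bsub>G\<^esub> f = b} =
        {s \<in> R \<inter> L. h \<otimes> s \<otimes> k = s}"
      unfolding bij_betw_imp_surj_on[OF bijG, symmetric] by auto
  qed auto
  then show ?thesis
    unfolding t_def b_def w_def by (simp add: bij_betw_same_card)
qed


section \<open>Distributing the fixed points over the H-classes\<close>

text \<open>If \<open>h s k = s\<close>, then \<open>h s\<close> and \<open>s k\<close> generate the same two-sided ideal as \<open>s\<close>. Stability
  makes \<open>h s\<close> \<open>\<R>\<close>-equivalent and \<open>s k\<close> \<open>\<L>\<close>-equivalent to \<open>s\<close>.\<close>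

lemma fixed_point_classes:
  assumes c: "s \<in> carrier M" "h \<in> carrier M" "k \<in> carrier M" and fx: "h \<otimes> s \<otimes> k = s"
  shows "h <# R_class M s = R_class M s" "L_class M s #> k = L_class M s"
proof -
  have "h \<otimes> s = h \<otimes> (h \<otimes> s \<otimes> k) \<otimes> \<one>" using c fx by simp
  then have "s \<in> R_class M (h \<otimes> s)" using right_stable[of "h \<otimes> s" k h \<one>] c fx by simp
  then have "h \<otimes> s \<in> R_class M s" using c by (simp add: R_class_def)
  then show "h <# R_class M s = R_class M s" using left_mult_R_class c by blast
  have fx': "h \<otimes> (s \<otimes> k) = s" using c fx by (simp add: m_assoc)
  then have "s \<otimes> k = \<one> \<otimes> (h \<otimes> (s \<otimes> k)) \<otimes> k" using c by simp
  then have "s \<in> L_class M (s \<otimes> k)" using left_stable[of "s \<otimes> k" h \<one> k] c fx' by simp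
  then have "s \<otimes> k \<in> L_class M s" using c by (simp add: L_class_def)
  then show "L_class M s #> k = L_class M s" using right_mult_L_class c by blast
qed

lemma card_fixed_eq_sum:
  assumes a: "a \<in> carrier M" and J: "J = J_class M a"
    and hk: "h \<in> carrier M" "k \<in> carrier M"
  shows "card {s \<in> J. h \<otimes> s \<otimes> k = s} =
    (\<Sum>R\<in>S_R M J h. \<Sum>L\<in>S_L M J k. card {s \<in> R \<inter> L. h \<otimes> s \<otimes> k = s})"
    and "finite (S_R M J h)" and "finite (S_L M J k)"
proof -
  show fin: "finite (S_R M J h)" "finite (S_L M J k)"
    using finite_carrier by (simp_all add: S_R_def S_L_def R_classes_def L_classes_def)
  let ?F = "\<lambda>(R, L). {s \<in> R \<inter> L. h \<otimes> s \<otimes> k = s}"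
  have finF: "finite (?F (R, L))" if "(R, L) \<in> S_R M J h \<times> S_L M J k" for R L
  proof (rule finite_subset[OF _ finite_carrier])
    show "?F (R, L) \<subseteq> carrier M"
      using that by (auto simp: S_R_def R_classes_def R_class_carrier)
  qed
  have disj: "?F p \<inter> ?F p' = {}"
    if "p \<in> S_R M J h \<times> S_L M J k" "p' \<in> S_R M J h \<times> S_L M J k" "p \<noteq> p'" for p p'
  proof (rule ccontr)
    assume "?F p \<inter> ?F p' \<noteq> {}"
    then obtain s where "s \<in> fst p" "s \<in> snd p" "s \<in> fst p'" "s \<in> snd p'"
      by (auto split: prod.splits)
    moreover have "fst q = R_class M s" if "q \<in> S_R M J h \<times> S_L M J k" "s \<in> fst q" for q
      using that by (auto simp: S_R_def R_classes_def R_class_def)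
    moreover have "snd q = L_class M s" if "q \<in> S_R M J h \<times> S_L M J k" "s \<in> snd q" for q
      using that by (auto simp: S_L_def L_classes_def L_class_def)
    ultimately have "fst p = fst p'" "snd p = snd p'" using that(1,2) by metis+
    then have "p = p'" by (rule prod_eqI)
    with that(3) show False by simp
  qed
  have "{s \<in> J. h \<otimes> s \<otimes> k = s} = (\<Union>p \<in> S_R M J h \<times> S_L M J k. ?F p)"
  proof (intro equalityI subsetI)
    fix s assume "s \<in> {s \<in> J. h \<otimes> s \<otimes> k = s}"
    then have sJ: "s \<in> J" and fx: "h \<otimes> s \<otimes> k = s" by simp_all
    have s: "s \<in> carrier M" using sJ J by (simp add: J_class_def)
    have "J_class M s = J" using sJ J J_class_eq by simp
    then have "R_class M s \<in> S_R M J h" "L_class M s \<in> S_L M J k"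
      using fixed_point_classes[OF s hk fx] R_class_subset_J_class[OF s] L_class_subset_J_class[OF s] s
      by (simp_all add: S_R_def S_L_def R_classes_def L_classes_def)
    then show "s \<in> (\<Union>p \<in> S_R M J h \<times> S_L M J k. ?F p)"
      using fx R_class_self[OF s] L_class_self[OF s] by blast
  next
    fix s assume "s \<in> (\<Union>p \<in> S_R M J h \<times> S_L M J k. ?F p)"
    then show "s \<in> {s \<in> J. h \<otimes> s \<otimes> k = s}" by (auto simp: S_R_def)
  qed
  then have "card {s \<in> J. h \<otimes> s \<otimes> k = s} = (\<Sum>p \<in> S_R M J h \<times> S_L M J k. card (?F p))"
    using fin finF disj by (simp only:) (rule card_UN_disjoint, auto)
  then show "card {s \<in> J. h \<otimes> s \<otimes> k = s} =
    (\<Sum>R\<in>S_R M J h. \<Sum>L\<in>S_L M J k. card {s \<in> R \<inter> L. h \<otimes> s \<otimes> k = s})"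
    by (simp add: sum.cartesian_product case_prod_unfold)
qed

end


section \<open>Counting the solutions of \<open>h s k = s\<close> in a J-class\<close>

theorem mainTheorem1:
  fixes M :: "('a, 'b) monoid_scheme" (structure)
    and J :: "'a set"
    and a h k :: 'a
    and lam lam' rho rho' :: "'a set \<Rightarrow> 'a"
  assumes "monoid M"
    and "finite (carrier M)"
    and "J \<in> J_classes M"
    and "a \<in> J"
    and "h \<in> carrier M"
    and "k \<in> carrier M"
    and "\<And>R. R \<in> R_classes M \<Longrightarrow> R \<subseteq> J \<Longrightarrow> left_Green_pair M (R_class M a) R (lam R) (lam' R)"
    and "\<And>L. L \<in> L_classes M \<Longrightarrow> L \<subseteq> J \<Longrightarrow> right_Green_pair M (L_class M a) L (rho L) (rho' L)"
  shows "card {s \<in> J. h \<otimes> s \<otimes> k = s} =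
    (\<Sum>c \<in> conj_classes (right_schutz M (H_class M a)).
       r_vec M J a lam lam' h c * l_vec M J a rho rho' k c)"
proof -
  interpret finite_monoid M
    using assms(1,2) by (simp add: finite_monoid_def finite_monoid_axioms_def)
  have a: "a \<in> carrier M" and J: "J = J_class M a"
    using assms(3,4) J_class_eq by (auto simp: J_classes_def J_class_def)
  let ?H = "H_class M a"
  let ?G = "right_schutz M ?H"
  interpret G: group ?G using group_schutz[OF a] .
  let ?f = "\<lambda>R. inv\<^bsub>?G\<^esub> (tau M a (left_mult_map M ?H (lam' R \<otimes> h \<otimes> lam R)))"
  let ?g = "\<lambda>L. right_mult_map M ?H (rho L \<otimes> k \<otimes> rho' L)"
  have aH: "a \<in> ?H" using a by (simp add: H_class_def L_class_self R_class_self)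
  have SR: "R \<in> R_classes M" "h <# R = R" "left_Green_pair M (R_class M a) R (lam R) (lam' R)"
    if "R \<in> S_R M J h" for R using that assms(7) by (auto simp: S_R_def)
  have SL: "L \<in> L_classes M" "L #> k = L" "right_Green_pair M (L_class M a) L (rho L) (rho' L)"
    if "L \<in> S_L M J k" for L using that assms(8) by (auto simp: S_L_def)
  have f: "?f R \<in> carrier ?G" if "R \<in> S_R M J h" for R
    using left_Green_conj_in_H[OF a SR(1)[OF that] assms(5) SR(2,3)[OF that]] aH
    by (intro G.inv_closed tau_schutz(1)[OF a]) (simp add: left_mult_map_def)
  have g: "?g L \<in> carrier ?G" if "L \<in> S_L M J k" for L
  proof -
    have "rho L \<otimes> k \<otimes> rho' L \<in> carrier M"
      using SL(3)[OF that] assms(6) by (simp add: right_Green_pair_def)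
    then show ?thesis
      using right_Green_conj_in_H[OF a SL(1)[OF that] assms(6) SL(2,3)[OF that]]
      by (intro right_mult_map_in_schutz[OF a])
  qed
  have "card {s \<in> J. h \<otimes> s \<otimes> k = s} =
    (\<Sum>R\<in>S_R M J h. \<Sum>L\<in>S_L M J k. card {s \<in> R \<inter> L. h \<otimes> s \<otimes> k = s})"
    using card_fixed_eq_sum(1)[OF a J assms(5,6)] .
  also have "\<dots> = (\<Sum>R\<in>S_R M J h. \<Sum>L\<in>S_L M J k.
      card {x \<in> carrier ?G. x \<otimes>\<^bsub>?G\<^esub> ?f R \<otimes>\<^bsub>?G\<^esub> inv\<^bsub>?G\<^esub> x = ?g L})"
    by (intro sum.cong refl card_fixed_in_class a SR SL assms(5,6))
  also have "\<dots> = (\<Sum>c \<in> conj_classes ?G. class_centralizer_card ?G c *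
      card {R \<in> S_R M J h. ?f R \<in> c} * card {L \<in> S_L M J k. ?g L \<in> c})"
    by (rule G.sum_card_conjugators[OF finite_schutz card_fixed_eq_sum(2,3)[OF a J assms(5,6)] f g])
  finally show ?thesis by (simp add: r_vec_def l_vec_def)
qed

end
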